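(* Let $n \ge 2$ and let $D$ be an open, convex, bounded and symmetric (that is, $D=-D$) subset of $\mathbb{R}^n$. Assume that there exists a number $N$ such that, for all $\omega \in S^{n-1}$, the function $p \mapsto V(\omega,p)$ is a polynomial of degree $\le N$. Then $\partial D$ must be an ellipsoid.
   Context: For $\omega\in S^{n-1}$ and $p \in \mathbb{R}$ let $L(\omega,p)$ be the hyperplane $\{x\in\mathbb{R}^n : x\cdot\omega = p\}$. For those $(\omega,p)$ for which $L(\omega,p)$ intersects $D$, i.e. $\inf\{x\cdot\omega : x\in D\} < p < \sup\{x\cdot\omega : x \in D\}$, $V(\omega,p)$ denotes the volume of one of the components of $D\setminus L(\omega,p)$, say $\{x\in D: x\cdot\omega < p\}$ (using the other component replaces $V$ by $\mathrm{vol}(D) - V$). The polynomial hypothesis concerns $p$ in this open interval. *)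

theory Defs
  imports "HOL-Analysis.Analysis" "HOL-Computational_Algebra.Polynomial"
begin

definition cap_volume :: "(real ^ 'n) set \<Rightarrow> real ^ 'n \<Rightarrow> real \<Rightarrow> real" where
  "cap_volume D \<omega> p = measure lebesgue {x \<in> D. x \<bullet> \<omega> < p}"

text \<open>The open interval of those \<open>p\<close> for which the hyperplane \<open>x \<bullet> \<omega> = p\<close> cuts \<open>D\<close>.
  The infimum and supremum are only meaningful for nonempty bounded \<open>D\<close>.\<close>

definition cut_interval :: "(real ^ 'n) set \<Rightarrow> real ^ 'n \<Rightarrow> real set" where
  "cut_interval D \<omega> = {(INF x\<in>D. x \<bullet> \<omega>) <..< (SUP x\<in>D. x \<bullet> \<omega>)}"

definition positive_definite :: "real ^ 'n ^ 'n \<Rightarrow> bool" where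
  "positive_definite A \<longleftrightarrow> transpose A = A \<and> (\<forall>x. x \<noteq> 0 \<longrightarrow> x \<bullet> (A *v x) > 0)"

text \<open>An ellipsoid is a hypersurface here (not the solid body), nondegenerate and with
  arbitrary centre \<open>c\<close>.\<close>

definition ellipsoid :: "(real ^ 'n) set \<Rightarrow> bool" where
  "ellipsoid E \<longleftrightarrow>
    (\<exists>A c. positive_definite A \<and> E = {x. (x - c) \<bullet> (A *v (x - c)) = 1})"

end

theory Submission
  imports Defs
    "HOL-Computational_Algebra.Field_as_Ring"
    "HOL-Computational_Algebra.Polynomial_Factorial"
begin

text \<open>Let \<open>h\<close> be the support function of \<open>D\<close>. For a unit vector \<open>\<omega>\<close>, the volume of \<open>D\<close> beyond the
  hyperplane \<open>x \<bullet> \<omega> = p\<close> is a polynomial in \<open>p\<close> on \<open>{- h \<omega><..<h \<omega>}\<close>, so the projection of Lebesgue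
  measure on \<open>D\<close> to the line spanned by \<open>\<omega>\<close> has a polynomial density of degree at most \<open>N\<close>.
  Integrating powers against it shows that the even moments are
  \<open>M\<^sub>k(\<omega>) = (\<integral>x\<in>D. (x \<bullet> \<omega>) ^ (2 * k)) = h(\<omega>) ^ (2 * k) * R\<^sub>\<omega>(k)\<close>,
  where \<open>R\<^sub>\<omega>\<close> is a rational function of \<open>k\<close> whose denominator \<open>\<Prod>i\<le>N. (2 * k + i + 1)\<close> does not depend
  on \<open>\<omega>\<close>. By homogeneity this holds for all nonzero \<open>\<omega>\<close> (\<open>moment_exponential_polynomial\<close>).

  On the other hand \<open>M\<^sub>k\<close> is a polynomial in \<open>\<omega>\<close>. Along a line \<open>u + t *\<^sub>R v\<close> that avoids the origin one
  thus has, for every \<open>k\<close>, a polynomial in \<open>t\<close> of the form \<open>P\<^sub>t(k) * f(t) ^ k\<close> with \<open>f(t) = (h (u + t *\<^sub>R v))\<^sup>2\<close>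
  and \<open>P\<^sub>t\<close> a polynomial in \<open>k\<close> of degree at most \<open>N\<close>, which is a positive constant for \<open>k = 0\<close>. Such an
  \<open>f\<close> is a polynomial (\<open>exponential_polynomial_base\<close>): it is rational, because the sequence satisfies
  a linear recurrence over \<open>\<real>[t]\<close> whose characteristic polynomial is a multiple of a power of \<open>X - f\<close>, and
  it is integral over \<open>\<real>[t]\<close>.

  Exchanging \<open>u\<close> and \<open>v\<close> shows that \<open>f\<close> has degree two with leading coefficient \<open>(h v)\<^sup>2\<close>. Hence \<open>h\<^sup>2\<close>
  satisfies the parallelogram law and is a positive definite quadratic form \<open>w \<bullet> T w\<close>. The
  description of the boundary by supporting hyperplanes then identifies the frontier of \<open>D\<close> with the ellipsoid
  \<open>x \<bullet> inv T x = 1\<close> (\<open>quadratic_support_ellipsoid\<close>).\<close>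

section \<open>Exponential polynomials with polynomial values\<close>

text \<open>A homogeneous linear system over an integral domain with fewer equations than unknowns has a
  nontrivial solution: elimination without division, by induction on the set of equations.\<close>

lemma underdetermined_system:
  fixes A :: "'i \<Rightarrow> 'j \<Rightarrow> 'a::idom"
  assumes "finite I" "finite J" "card I < card J"
  shows "\<exists>x. (\<exists>j\<in>J. x j \<noteq> 0) \<and> (\<forall>i\<in>I. (\<Sum>j\<in>J. A i j * x j) = 0)"
  using assms
proof (induction I arbitrary: A J rule: finite_induct)
  case empty
  then have "J \<noteq> {}" by auto
  then show ?case by (intro exI[of _ "\<lambda>_. 1"]) auto
next
  case (insert i I)
  show ?case
  proof (cases "\<forall>j\<in>J. A i j = 0")
    case True
    have "card I < card J" using insert by simp
    with insert.IH[OF \<open>finite J\<close>, of A] obtain x where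
      "\<exists>j\<in>J. x j \<noteq> 0" "\<forall>i\<in>I. (\<Sum>j\<in>J. A i j * x j) = 0" by blast
    with True show ?thesis by (intro exI[of _ x]) auto
  next
    case False
    then obtain j0 where j0: "j0 \<in> J" "A i j0 \<noteq> 0" by auto
    define J' where "J' = J - {j0}"
    define A' where "A' = (\<lambda>i' j. A i j0 * A i' j - A i' j0 * A i j)"
    have "card I < card J'" "finite J'" using insert j0 by (auto simp: J'_def)
    with insert.IH[of J' A'] obtain y where
      y: "\<exists>j\<in>J'. y j \<noteq> 0" "\<forall>i'\<in>I. (\<Sum>j\<in>J'. A' i' j * y j) = 0" by blast
    define x where "x = (\<lambda>j. if j = j0 then - (\<Sum>j\<in>J'. A i j * y j) else A i j0 * y j)"
    have split: "(\<Sum>j\<in>J. A i' j * x j) =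
        - A i' j0 * (\<Sum>j\<in>J'. A i j * y j) + (\<Sum>j\<in>J'. A i' j * (A i j0 * y j))" for i'
    proof -
      have "(\<Sum>j\<in>J. A i' j * x j) = A i' j0 * x j0 + (\<Sum>j\<in>J'. A i' j * x j)"
        unfolding J'_def using insert.prems j0 by (simp add: sum.remove)
      also have "(\<Sum>j\<in>J'. A i' j * x j) = (\<Sum>j\<in>J'. A i' j * (A i j0 * y j))"
        by (intro sum.cong) (auto simp: x_def J'_def)
      finally show ?thesis by (simp add: x_def)
    qed
    have "(\<Sum>j\<in>J. A i j * x j) = 0"
      unfolding split by (simp add: sum_distrib_left sum_negf mult_ac)
    moreover have "(\<Sum>j\<in>J. A i' j * x j) = 0" if "i' \<in> I" for i'
    proof -
      have "(\<Sum>j\<in>J. A i' j * x j) = (\<Sum>j\<in>J'. A' i' j * y j)"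
        unfolding split A'_def sum_distrib_left sum.distrib[symmetric]
        by (intro sum.cong) (auto simp: algebra_simps)
      with y that show ?thesis by simp
    qed
    moreover have "\<exists>j\<in>J. x j \<noteq> 0"
      using y(1) j0 by (auto simp: x_def J'_def)
    ultimately show ?thesis by (intro exI[of _ x]) auto
  qed
qed

text \<open>In characteristic zero the translates of a nonzero polynomial \<open>P\<close> span all polynomials of degree at
  most \<open>degree P\<close>. Hence a functional \<open>g \<mapsto> \<Sum>i\<le>n. b i * g i\<close> that kills \<open>degree P + 1\<close> translates
  of \<open>P\<close> kills every polynomial of degree at most \<open>degree P\<close>. The span is reached through the
  successive derivatives of \<open>P\<close>.\<close>

lemma shift_annihilation:
  fixes P g :: "real poly" and b :: "nat \<Rightarrow> real"
  assumes "P \<noteq> 0"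
    and "\<And>k. k \<le> degree P \<Longrightarrow> (\<Sum>i\<le>n. b i * poly P (real (k + i))) = 0"
    and "degree g \<le> degree P"
  shows "(\<Sum>i\<le>n. b i * poly g (real i)) = 0"
proof -
  define R where "R = (\<lambda>Q. \<Sum>i\<le>n. smult (b i) (pcompose Q [:real i, 1:]))"
  have poly_R: "poly (R Q) x = (\<Sum>i\<le>n. b i * poly Q (x + real i))" for Q x
    by (simp add: R_def poly_sum poly_pcompose add.commute)
  \<comment> \<open>\<open>R P\<close> has degree at most \<open>degree P\<close> but vanishes at \<open>0, \<dots>, degree P\<close>.\<close>
  have R0: "R P = 0"
  proof (rule ccontr)
    assume nz: "R P \<noteq> 0"
    have "degree (R P) \<le> degree P"
      unfolding R_def by (intro degree_sum_le) (auto intro!: order.trans[OF degree_smult_le] simp: degree_pcompose)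
    moreover have "real ` {..degree P} \<subseteq> {x. poly (R P) x = 0}"
      using assms(2) by (auto simp: poly_R)
    then have "card (real ` {..degree P}) \<le> card {x. poly (R P) x = 0}"
      by (intro card_mono poly_roots_finite nz)
    then have "Suc (degree P) \<le> card {x. poly (R P) x = 0}"
      by (simp add: card_image)
    moreover have "card {x. poly (R P) x = 0} \<le> degree (R P)"
      by (rule card_poly_roots_bound[OF nz])
    ultimately show False by simp
  qed
  have "poly (R g) 0 = 0"
    using \<open>P \<noteq> 0\<close> R0 \<open>degree g \<le> degree P\<close>
  proof (induction "degree P" arbitrary: P g)
    case 0
    then obtain c e where ce: "P = [:c:]" "g = [:e:]"
      by (metis degree_eq_zeroE le_zero_eq)
    with 0 have "c \<noteq> 0" by simp
    have "poly (R P) 0 = 0" using 0 by simp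
    with ce \<open>c \<noteq> 0\<close> have "(\<Sum>i\<le>n. b i) = 0"
      by (simp add: poly_R flip: sum_distrib_right)
    with ce show ?case by (simp add: poly_R flip: sum_distrib_right)
  next
    case (Suc d)
    \<comment> \<open>\<open>R\<close> commutes with differentiation, so the hypothesis passes from \<open>P\<close> to its derivative.\<close>
    have R': "R (pderiv Q) = pderiv (R Q)" for Q
      by (simp add: R_def higher_pderiv_sum[of 1, simplified] pderiv_smult pderiv_pcompose pderiv_pCons)
    define c where "c = coeff g (degree P) / lead_coeff P"
    define h where "h = g - smult c P"
    have "coeff h (degree P) = 0" using Suc by (simp add: h_def c_def)
    moreover have "degree h \<le> degree P"
      unfolding h_def using Suc by (intro degree_diff_le) auto
    ultimately have "degree h \<le> d"
      using Suc(2) by (metis coeff_0_degree_minus_1 diff_Suc_1 degree_0 le_0_eq nat_le_linear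
          leading_coeff_0_iff le_antisym not_less_eq_eq)
    moreover have "d = degree (pderiv P)" using Suc by (simp add: degree_pderiv)
    moreover from this have "pderiv P \<noteq> 0" using Suc by (metis pderiv_eq_0_iff nat.distinct(1))
    moreover have "R (pderiv P) = 0" using Suc by (simp add: R')
    ultimately have "poly (R h) 0 = 0" using Suc(1)[of "pderiv P" h] by simp
    moreover have "poly (R P) 0 = 0" using Suc by simp
    moreover have "poly (R g) 0 = poly (R h) 0 + c * poly (R P) 0"
      by (simp add: poly_R h_def sum_distrib_left algebra_simps flip: sum.distrib)
    ultimately show ?case by simp
  qed
  then show ?thesis by (simp add: poly_R)
qed

lemma alternating_binomial_sum_poly:
  fixes P :: "real poly"
  assumes "degree P < n"
  shows "(\<Sum>i\<le>n. (-1) ^ i * real (n choose i) * poly P (x + real i)) = 0"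
  using assms
proof (induction n arbitrary: P)
  case (Suc n)
  define Q where "Q = P - pcompose P [:1, 1:]"
  have step: "(\<Sum>i\<le>Suc n. (-1) ^ i * real (Suc n choose i) * poly P (x + real i))
      = (\<Sum>i\<le>n. (-1) ^ i * real (n choose i) * poly Q (x + real i))"
  proof -
    let ?h = "\<lambda>i. poly P (x + real i)"
    have "(\<Sum>i\<le>Suc n. (-1) ^ i * real (Suc n choose i) * ?h i)
        = ?h 0 + (\<Sum>i\<le>n. (-1) ^ Suc i * real (Suc n choose Suc i) * ?h (Suc i))"
      by (subst sum.atMost_Suc_shift) simp
    also have "\<dots> = (?h 0 + (\<Sum>i\<le>n. (-1) ^ Suc i * real (n choose Suc i) * ?h (Suc i)))
        - (\<Sum>i\<le>n. (-1) ^ i * real (n choose i) * ?h (Suc i))"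
      by (simp add: algebra_simps sum.distrib sum_negf sum_subtractf)
    also have "?h 0 + (\<Sum>i\<le>n. (-1) ^ Suc i * real (n choose Suc i) * ?h (Suc i))
        = (\<Sum>i\<le>Suc n. (-1) ^ i * real (n choose i) * ?h i)"
      by (subst sum.atMost_Suc_shift) simp
    also have "\<dots> = (\<Sum>i\<le>n. (-1) ^ i * real (n choose i) * ?h i)"
      by simp
    finally show ?thesis
      by (simp add: Q_def poly_pcompose algebra_simps flip: sum_subtractf)
  qed
  show ?case
  proof (cases "degree P = 0")
    case True
    then obtain c where "P = [:c:]" by (rule degree_eq_zeroE)
    then show ?thesis unfolding step by (simp add: Q_def)
  next
    case False
    have "coeff Q (degree P) = 0"
      using lead_coeff_comp[of "[:1, 1:]" P] by (simp add: Q_def degree_pcompose)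
    moreover have "degree Q \<le> degree P" by (simp add: Q_def degree_diff_le degree_pcompose)
    ultimately have "degree Q < degree P"
      by (metis False bot_nat_0.not_eq_extremum degree_0 le_neq_implies_less leading_coeff_0_iff)
    then show ?thesis unfolding step using Suc by simp
  qed
qed simp

text \<open>A functional supported on \<open>0, \<dots>, d + 1\<close> that kills all polynomials of degree at most \<open>d\<close> is
  determined by its last coefficient. To see this, test it on the polynomial of degree \<open>d\<close> that vanishes at all
  points up to \<open>d\<close> except \<open>m\<close>.\<close>

lemma coefficient_by_last_coefficient:
  fixes b :: "nat \<Rightarrow> real"
  assumes b: "\<And>g::real poly. degree g \<le> d \<Longrightarrow> (\<Sum>i\<le>Suc d. b i * poly g (real i)) = 0"
    and "m \<le> d"
  shows "b m * (\<Prod>j\<in>{..d} - {m}. real m - real j) =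
    - b (Suc d) * (\<Prod>j\<in>{..d} - {m}. real (Suc d) - real j)"
proof -
  define g :: "real poly" where "g = (\<Prod>j\<in>{..d} - {m}. [:- real j, 1:])"
  have poly_g: "poly g x = (\<Prod>j\<in>{..d} - {m}. x - real j)" for x
    by (simp add: g_def poly_prod)
  have "degree g = d"
    unfolding g_def using \<open>m \<le> d\<close> by (subst degree_prod_eq_sum_degree) auto
  with b[of g] have "(\<Sum>i\<le>Suc d. b i * poly g (real i)) = 0" by simp
  moreover have "(\<Sum>i\<le>d. b i * poly g (real i)) = b m * poly g (real m)"
  proof -
    have "(\<Sum>i\<in>{..d} - {m}. b i * poly g (real i)) = 0"
      by (intro sum.neutral) (auto simp: poly_g)
    then show ?thesis using \<open>m \<le> d\<close> by (subst sum.remove[of _ m]) auto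
  qed
  ultimately show ?thesis by (simp add: poly_g)
qed

lemma poly_eq_if_infinite:
  fixes p q :: "'a::idom poly"
  assumes "infinite T" "\<And>t. t \<in> T \<Longrightarrow> poly p t = poly q t"
  shows "p = q"
proof (rule ccontr)
  assume "p \<noteq> q"
  then have "finite {t. poly (p - q) t = 0}" by (intro poly_roots_finite) simp
  moreover have "T \<subseteq> {t. poly (p - q) t = 0}" using assms(2) by auto
  ultimately show False using assms(1) finite_subset by blast
qed

text \<open>The algebraic core. If \<open>P t k * f t ^ k\<close> is a polynomial in \<open>t\<close> for every \<open>k\<close>, where \<open>P t\<close> is a
  polynomial in \<open>k\<close> of bounded degree and \<open>f\<close> has no zeros, and if for \<open>k = 0\<close> it is a nonzero constant,
  then \<open>f\<close> itself is a polynomial. No regularity of \<open>f\<close> or of \<open>t \<mapsto> P t\<close> is needed.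

  With \<open>d\<close> the generic degree of \<open>P t\<close>, the sequence \<open>F\<close> satisfies a linear recurrence of order
  \<open>d + 1\<close> with coefficients in \<open>\<real>[t]\<close>. For generic \<open>t\<close> its characteristic polynomial must be a
  constant multiple of \<open>(X - f t) ^ (d + 1)\<close>, and comparing its two top coefficients exhibits \<open>f\<close> as a rational function
  \<open>A / B\<close>. The recurrence with characteristic polynomial \<open>(X - f t) ^ (d + 1)\<close> is an integrality
  relation for \<open>f\<close>, because \<open>F 0\<close> is constant, and so \<open>B\<close> is constant.\<close>

lemma exponential_polynomial_base:
  fixes F :: "nat \<Rightarrow> real poly" and P :: "real \<Rightarrow> real poly" and f :: "real \<Rightarrow> real"
  assumes F: "\<And>t k. poly (F k) t = poly (P t) (real k) * f t ^ k"
    and deg: "\<And>t. degree (P t) \<le> m"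
    and f0: "\<And>t. f t \<noteq> 0"
    and c: "F 0 = [:c:]" "c \<noteq> 0"
  shows "\<exists>A. \<forall>t. poly A t = f t"
proof -
  have P0: "P t \<noteq> 0" for t
    using F[of 0 t] c by auto
  \<comment> \<open>The generic degree: \<open>degree (P t) = d\<close> on an infinite set \<open>S\<close>.\<close>
  define d where "d = (GREATEST d. infinite {t. d \<le> degree (P t)})"
  have bound: "d \<le> m" if "infinite {t. d \<le> degree (P t)}" for d
  proof (rule ccontr)
    assume "\<not> d \<le> m"
    then have "{t. d \<le> degree (P t)} = {}" using deg by (auto intro: order.trans)
    with that show False by simp
  qed
  have d: "infinite {t. d \<le> degree (P t)}"
    unfolding d_def
  proof (rule GreatestI_nat[of _ 0 m])
    show "infinite {t. 0 \<le> degree (P t)}" by (simp add: infinite_UNIV_char_0)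
  qed (rule bound)
  have "\<not> infinite {t. Suc d \<le> degree (P t)}"
    using Greatest_le_nat[of "\<lambda>d. infinite {t. d \<le> degree (P t)}" "Suc d" m] bound
    unfolding d_def by auto
  moreover define S where "S = {t. degree (P t) = d}"
  moreover have "{t. d \<le> degree (P t)} \<subseteq> S \<union> {t. Suc d \<le> degree (P t)}"
    by (auto simp: S_def)
  ultimately have S: "infinite S"
    using d by (metis finite_UnI finite_subset)
  \<comment> \<open>\<open>d + 1\<close> equations in the \<open>d + 2\<close> unknown coefficients of the recurrence.\<close>
  obtain a where a: "\<exists>i\<in>{..Suc d}. a i \<noteq> 0"
      "\<forall>k\<in>{..d}. (\<Sum>i\<le>Suc d. F (k + i) * a i) = 0"
    using underdetermined_system[of "{..d}" "{..Suc d}" "\<lambda>k i. F (k + i)"] by auto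
  have ann: "(\<Sum>i\<le>Suc d. poly (a i) t * f t ^ i * poly g (real i)) = 0"
    if "t \<in> S" "degree g \<le> d" for t g
  proof (rule shift_annihilation[OF P0[of t]])
    fix k assume "k \<le> degree (P t)"
    then have "k \<le> d" using that by (simp add: S_def)
    then have "poly (\<Sum>i\<le>Suc d. F (k + i) * a i) t = 0" using a by simp
    also have "poly (\<Sum>i\<le>Suc d. F (k + i) * a i) t =
        f t ^ k * (\<Sum>i\<le>Suc d. poly (a i) t * f t ^ i * poly (P t) (real (k + i)))"
      unfolding poly_sum sum_distrib_left
      by (intro sum.cong) (auto simp: F power_add)
    finally show "(\<Sum>i\<le>Suc d. poly (a i) t * f t ^ i * poly (P t) (real (k + i))) = 0"
      using f0 by simp
  qed (use that in \<open>simp add: S_def\<close>)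
  have by_last: "poly (a m) t * f t ^ m * (\<Prod>j\<in>{..d} - {m}. real m - real j) =
    - (poly (a (Suc d)) t * f t ^ Suc d) * (\<Prod>j\<in>{..d} - {m}. real (Suc d) - real j)"
    if "m \<le> d" "t \<in> S" for m t
    by (rule coefficient_by_last_coefficient) (use ann that in auto)
  have a_top: "a (Suc d) \<noteq> 0"
  proof
    assume top: "a (Suc d) = 0"
    have "a i = 0" if "i \<le> d" for i
      using by_last[OF that] top f0 that by (intro poly_eq_if_infinite[OF S]) auto
    with top a(1) show False by (auto simp: le_Suc_eq)
  qed
  have "\<exists>A B. coprime A B \<and> (\<exists>T\<subseteq>S. infinite T \<and> (\<forall>t\<in>T. poly A t = f t * poly B t))"
  proof -
    define u v where "u = (\<Prod>j<d. real d - real j)" and "v = (\<Prod>j<d. real (Suc d) - real j)"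
    have uv: "u \<noteq> 0" "v \<noteq> 0" by (auto simp: u_def v_def)
    define A B where "A = smult (-u) (a d)" and "B = smult v (a (Suc d))"
    have AB: "poly A t = f t * poly B t" if "t \<in> S" for t
    proof -
      have "{..d} - {d} = {..<d}" by auto
      then have "f t ^ d * (poly (a d) t * u) = f t ^ d * (- f t * poly (a (Suc d)) t * v)"
        using by_last[of d t] that by (simp add: u_def v_def mult_ac)
      then have "poly (a d) t * u = - f t * poly (a (Suc d)) t * v"
        unfolding mult_cancel_left using f0 by simp
      then show ?thesis by (simp add: A_def B_def mult_ac)
    qed
    have "gcd A B \<noteq> 0" using a_top uv by (simp add: B_def)
    then obtain A' B' where AB': "A = A' * gcd A B" "B = B' * gcd A B" "coprime A' B'"
      using gcd_coprime_exists by blast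
    have "infinite (S - {t. poly (gcd A B) t = 0})"
      using S poly_roots_finite[OF \<open>gcd A B \<noteq> 0\<close>] by simp
    moreover have "poly A' t = f t * poly B' t" if "t \<in> S - {t. poly (gcd A B) t = 0}" for t
    proof -
      have "poly A t = poly A' t * poly (gcd A B) t" "poly B t = poly B' t * poly (gcd A B) t"
        using AB'(1,2) by (metis poly_mult)+
      with AB[of t] that show ?thesis by simp
    qed
    ultimately show ?thesis using AB'(3) by blast
  qed
  then obtain A B T where AB: "coprime A B" "T \<subseteq> S" "infinite T" "\<And>t. t \<in> T \<Longrightarrow> poly A t = f t * poly B t"
    by blast
  \<comment> \<open>The binomial recurrence, with \<open>A / B\<close> in place of \<open>f\<close> and denominators cleared. It holds on the
    infinite set \<open>T\<close>, hence identically.\<close>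
  have recur: "(\<Sum>i\<le>Suc d. [:(-1) ^ i * real (Suc d choose i):] * A ^ (Suc d - i) * B ^ i * F (k + i)) = 0"
    if A: "\<And>t. t \<in> T \<Longrightarrow> poly A t = f t * poly B t" for A B k
  proof (rule poly_eq_if_infinite[OF AB(3)])
    fix t assume "t \<in> T"
    then have "degree (P t) < Suc d" using AB(2) by (auto simp: S_def)
    note alt = alternating_binomial_sum_poly[OF this, of "real k"]
    have "poly (\<Sum>i\<le>Suc d. [:(-1) ^ i * real (Suc d choose i):] * A ^ (Suc d - i) * B ^ i * F (k + i)) t
        = f t ^ k * f t ^ Suc d * poly B t ^ Suc d *
          (\<Sum>i\<le>Suc d. (-1) ^ i * real (Suc d choose i) * poly (P t) (real k + real i))"
      unfolding poly_sum sum_distrib_left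
    proof (intro sum.cong refl)
      fix i assume "i \<in> {..Suc d}"
      then have "x ^ Suc d = x ^ (Suc d - i) * x ^ i" for x :: real
        by (simp flip: power_add)
      then show "poly ([:(- 1) ^ i * real (Suc d choose i):] * A ^ (Suc d - i) * B ^ i * F (k + i)) t =
          f t ^ k * f t ^ Suc d * poly B t ^ Suc d *
            ((- 1) ^ i * real (Suc d choose i) * poly (P t) (real k + real i))"
        by (simp add: A[OF \<open>t \<in> T\<close>] F power_add power_mult_distrib mult_ac del: power_Suc)
    qed
    then show "poly (\<Sum>i\<le>Suc d. [:(-1) ^ i * real (Suc d choose i):] * A ^ (Suc d - i) * B ^ i * F (k + i)) t = poly 0 t"
      using alt by simp
  qed
  \<comment> \<open>All terms of the recurrence at \<open>k = 0\<close> other than the first contain a factor \<open>B\<close>.\<close>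
  have "B dvd A ^ Suc d * F 0"
  proof -
    let ?R = "\<Sum>i\<le>d. [:(-1) ^ Suc i * real (Suc d choose Suc i):] * A ^ (d - i) * B ^ Suc i * F (Suc i)"
    have sum0: "A ^ Suc d * F 0 + ?R = 0"
      using recur[of A B 0, OF AB(4)] unfolding sum.atMost_Suc_shift by (simp add: one_pCons[symmetric])
    have "B dvd ?R"
      by (intro dvd_sum dvd_mult2[OF dvd_mult] dvd_power) simp
    from dvd_add_left_iff[OF this, of "A ^ Suc d * F 0"] show ?thesis
      unfolding sum0 by simp
  qed
  moreover have "coprime B (A ^ Suc d)" using AB(1) by (simp add: coprime_commute)
  ultimately have "B dvd F 0" by (simp add: coprime_dvd_mult_right_iff)
  then obtain r where r: "B = [:r:]" "r \<noteq> 0"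
    using c by (metis degree_eq_zeroE degree_pCons_0 dvd_imp_degree le_zero_eq pCons_0_0 pCons_eq_0_iff dvd_0_left_iff)
  define Q where "Q = smult (1 / r) A"
  have Q: "poly Q t = f t * poly 1 t" if "t \<in> T" for t
    using AB(4)[OF that] r by (simp add: Q_def)
  \<comment> \<open>At an exceptional \<open>t\<close> the nonzero sequence \<open>k \<mapsto> P t k * f t ^ k\<close> still satisfies the recurrence
    with characteristic polynomial \<open>(X - Q t) ^ (d + 1)\<close>. Testing the resulting functional on the
    constant \<open>1\<close> gives \<open>(Q t - f t) ^ (d + 1) = 0\<close>.\<close>
  have "poly Q t = f t" for t
  proof -
    have "(\<Sum>i\<le>Suc d. (-1) ^ i * real (Suc d choose i) * poly Q t ^ (Suc d - i) * f t ^ i * poly 1 (real i)) = 0"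
    proof (rule shift_annihilation[OF P0[of t]])
      fix k
      have "0 = poly (\<Sum>i\<le>Suc d. [:(-1) ^ i * real (Suc d choose i):] * Q ^ (Suc d - i) * 1 ^ i * F (k + i)) t"
        using recur[of Q 1 k, OF Q] by simp
      also have "\<dots> = f t ^ k *
        (\<Sum>i\<le>Suc d. (-1) ^ i * real (Suc d choose i) * poly Q t ^ (Suc d - i) * f t ^ i * poly (P t) (real (k + i)))"
        unfolding poly_sum sum_distrib_left
        by (intro sum.cong refl) (simp add: F power_add mult_ac)
      finally show "(\<Sum>i\<le>Suc d. (-1) ^ i * real (Suc d choose i) * poly Q t ^ (Suc d - i) * f t ^ i * poly (P t) (real (k + i))) = 0"
        using f0 by simp
    qed simp
    also have "(\<Sum>i\<le>Suc d. (-1) ^ i * real (Suc d choose i) * poly Q t ^ (Suc d - i) * f t ^ i * poly 1 (real i))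
        = (- f t + poly Q t) ^ Suc d"
      unfolding binomial_ring
      by (intro sum.cong refl) (simp add: power_minus[of "f t"] mult_ac)
    finally show ?thesis by auto
  qed
  then show ?thesis by blast
qed

text \<open>A polynomial \<open>A\<close> for which \<open>t\<^sup>2 * A (1 / t)\<close> is again a polynomial \<open>B\<close> has degree at most two,
  and \<open>B 0\<close> is its coefficient at \<open>t\<^sup>2\<close>. This bounds the degree of \<open>(h (u + t *\<^sub>R v))\<^sup>2\<close> in \<open>t\<close>
  without a growth estimate, for the support function \<open>h\<close> below.\<close>

lemma quadratic_if_reversible:
  fixes A B :: "real poly"
  assumes rev: "\<And>t. t \<noteq> 0 \<Longrightarrow> poly A t = t\<^sup>2 * poly B (1 / t)"
    and B0: "poly B 0 \<noteq> 0"
  shows "\<exists>a b. A = [:a, b, poly B 0:]"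
proof -
  let ?n = "degree B"
  have eq: "monom 1 ?n * A = monom 1 2 * reflect_poly B"
  proof (rule poly_eq_if_infinite)
    show "infinite (UNIV - {0::real})" by (simp add: infinite_UNIV_char_0)
    show "poly (monom 1 ?n * A) t = poly (monom 1 2 * reflect_poly B) t" if "t \<in> UNIV - {0}" for t
      using that rev[of t] by (simp add: poly_monom poly_reflect_poly_nz inverse_eq_divide)
  qed
  have deg: "degree (reflect_poly B) = ?n" using B0 by (simp add: poly_0_coeff_0)
  have "coeff A i = coeff (monom 1 2 * reflect_poly B) (?n + i)" for i
    by (simp flip: eq add: coeff_monom_mult)
  then have coeffs: "coeff A i = (if ?n + i < 2 then 0 else coeff (reflect_poly B) (?n + i - 2))" for i
    by (simp add: coeff_monom_mult)
  have "coeff A 2 = poly B 0"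
    by (simp add: coeffs coeff_reflect_poly poly_0_coeff_0)
  moreover have "coeff A i = 0" if "i > 2" for i
    unfolding coeffs using that deg by (auto intro: coeff_eq_0)
  ultimately have "A = [:coeff A 0, coeff A 1, poly B 0:]"
    by (intro poly_eqI) (auto simp: coeff_pCons numeral_2_eq_2 split: nat.split)
  then show ?thesis by blast
qed

section \<open>Support functions of symmetric convex bodies\<close>

text \<open>The support function of \<open>D\<close>. The supremum is meaningful for nonempty bounded \<open>D\<close>.\<close>

definition support_function :: "'a::real_inner set \<Rightarrow> 'a \<Rightarrow> real" where
  "support_function D w = (SUP x\<in>D. x \<bullet> w)"

locale symmetric_convex_body =
  fixes D :: "'a::euclidean_space set"
  assumes open_D: "open D" and convex_D: "convex D" and bounded_D: "bounded D"
    and nonempty_D: "D \<noteq> {}" and symmetric_D: "x \<in> D \<Longrightarrow> - x \<in> D"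
begin

abbreviation h :: "'a \<Rightarrow> real" where "h \<equiv> support_function D"

lemma inner_le_support: "x \<in> D \<Longrightarrow> x \<bullet> w \<le> h w"
proof -
  assume "x \<in> D"
  have "bounded ((\<lambda>x. x \<bullet> w) ` D)"
    by (intro bounded_linear_image bounded_D bounded_linear_inner_left)
  then show ?thesis
    unfolding support_function_def using \<open>x \<in> D\<close>
    by (intro cSUP_upper bounded_imp_bdd_above)
qed

lemma support_least: "(\<And>x. x \<in> D \<Longrightarrow> x \<bullet> w \<le> b) \<Longrightarrow> h w \<le> b"
  unfolding support_function_def by (intro cSUP_least nonempty_D)

lemma inner_less_support:
  assumes "x \<in> D" "w \<noteq> 0"
  shows "x \<bullet> w < h w"
proof -
  obtain e where e: "e > 0" "cball x e \<subseteq> D"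
    using open_D \<open>x \<in> D\<close> open_contains_cball by blast
  have "x + (e / norm w) *\<^sub>R w \<in> D"
    using e \<open>w \<noteq> 0\<close> by (intro subsetD[OF e(2)]) (simp add: dist_norm)
  from inner_le_support[OF this, of w] have "x \<bullet> w + (e / norm w) * (w \<bullet> w) \<le> h w"
    by (simp add: inner_add_left)
  moreover have "(e / norm w) * (w \<bullet> w) > 0"
    using e \<open>w \<noteq> 0\<close> by simp
  ultimately show ?thesis by simp
qed

lemma support_pos:
  assumes "w \<noteq> 0"
  shows "h w > 0"
proof -
  obtain x where "x \<in> D" using nonempty_D by blast
  with inner_less_support[of x w] inner_less_support[of "- x" w] symmetric_D assms
  show ?thesis by fastforce
qed

lemma support_zero [simp]: "h 0 = 0"
  using nonempty_D by (simp add: support_function_def)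

lemma support_nonneg: "h w \<ge> 0"
  using support_pos[of w] by (cases "w = 0") auto

lemma support_scaleR: "h (c *\<^sub>R w) = \<bar>c\<bar> * h w"
proof -
  have le: "h (c *\<^sub>R w) \<le> \<bar>c\<bar> * h w" for c w
  proof (rule support_least)
    fix x assume x: "x \<in> D"
    have "\<bar>x \<bullet> w\<bar> \<le> h w"
      using inner_le_support[OF x, of w] inner_le_support[OF symmetric_D[OF x], of w] by simp
    then have "\<bar>c\<bar> * \<bar>x \<bullet> w\<bar> \<le> \<bar>c\<bar> * h w" by (intro mult_left_mono) auto
    then show "x \<bullet> c *\<^sub>R w \<le> \<bar>c\<bar> * h w" by (simp add: abs_mult[symmetric])
  qed
  show ?thesis
  proof (cases "c = 0")
    case False
    have "h w \<le> \<bar>1 / c\<bar> * h (c *\<^sub>R w)" using le[of "1 / c" "c *\<^sub>R w"] False by simp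
    with False have "\<bar>c\<bar> * h w \<le> h (c *\<^sub>R w)" by (simp add: field_simps)
    with le[of c w] show ?thesis by simp
  qed simp
qed

lemma support_minus: "h (- w) = h w"
  using support_scaleR[of "-1" w] by simp

text \<open>The boundary points of \<open>D\<close> are the points of the closed body that lie on a supporting hyperplane.\<close>

lemma frontier_iff_support:
  "x \<in> frontier D \<longleftrightarrow> (\<forall>w. x \<bullet> w \<le> h w) \<and> (\<exists>w. w \<noteq> 0 \<and> x \<bullet> w = h w)"
proof
  assume x: "x \<in> frontier D"
  have "x \<bullet> w \<le> h w" for w
  proof -
    have "closure D \<subseteq> {x. w \<bullet> x \<le> h w}"
      by (intro closure_minimal closed_halfspace_le) (use inner_le_support[of _ w] in \<open>auto simp: inner_commute\<close>)
    with x show ?thesis by (auto simp: frontier_def inner_commute)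
  qed
  moreover have "\<exists>w. w \<noteq> 0 \<and> x \<bullet> w \<ge> h w"
  proof -
    have "x \<notin> D" using x open_D by (simp add: frontier_def interior_open)
    then obtain a b where "a \<noteq> 0" "\<forall>y\<in>D. a \<bullet> y \<le> b" "\<forall>y\<in>{x}. a \<bullet> y \<ge> b"
      using separating_hyperplane_sets[of D "{x}"] convex_D nonempty_D by auto
    then have "h a \<le> b" "b \<le> x \<bullet> a" by (auto intro!: support_least simp: inner_commute)
    with \<open>a \<noteq> 0\<close> show ?thesis by force
  qed
  ultimately show "(\<forall>w. x \<bullet> w \<le> h w) \<and> (\<exists>w. w \<noteq> 0 \<and> x \<bullet> w = h w)"
    by (meson antisym)
next
  assume x: "(\<forall>w. x \<bullet> w \<le> h w) \<and> (\<exists>w. w \<noteq> 0 \<and> x \<bullet> w = h w)"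
  then have "x \<notin> D" using inner_less_support by fastforce
  moreover have "x \<in> closure D"
  proof (rule ccontr)
    assume "x \<notin> closure D"
    then obtain a b where ab: "a \<bullet> x < b" "\<forall>y\<in>closure D. a \<bullet> y > b"
      using separating_hyperplane_closed_point[of "closure D" x] convex_D by (auto simp: convex_closure)
    have "h (- a) \<le> - b"
      using ab(2) closure_subset[of D] by (intro support_least) (force simp: inner_commute)
    with ab(1) x show False by (metis inner_commute inner_minus_left neg_less_iff_less not_less order.trans)
  qed
  ultimately show "x \<in> frontier D"
    using open_D by (simp add: frontier_def interior_open)
qed

end

section \<open>Bodies with quadratic squared support function\<close>

text \<open>Bodies whose squared support function is quadratic along every line, with leading coefficient the
  value at the direction of the line. By polarization the squared support function is then a positive
  definite quadratic form.\<close>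

locale quadratic_support = symmetric_convex_body +
  assumes quadratic_on_lines:
    "\<exists>b. \<forall>t. (h (u + t *\<^sub>R v))\<^sup>2 = (h u)\<^sup>2 + b * t + (h v)\<^sup>2 * t\<^sup>2"
begin

text \<open>The symmetric bilinear form whose quadratic form is \<open>h\<^sup>2\<close>.\<close>

definition polar_form :: "'a \<Rightarrow> 'a \<Rightarrow> real" where
  "polar_form u v = ((h (u + v))\<^sup>2 - (h (u - v))\<^sup>2) / 4"

lemma support_expand:
  "(h (u + t *\<^sub>R v))\<^sup>2 = (h u)\<^sup>2 + 2 * polar_form u v * t + (h v)\<^sup>2 * t\<^sup>2"
proof -
  obtain b where b: "\<And>t. (h (u + t *\<^sub>R v))\<^sup>2 = (h u)\<^sup>2 + b * t + (h v)\<^sup>2 * t\<^sup>2"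
    using quadratic_on_lines[of u v] by blast
  have "2 * polar_form u v = b"
    using b[of 1] b[of "-1"] by (simp add: polar_form_def)
  with b show ?thesis by simp
qed

lemma polar_form_commute: "polar_form u v = polar_form v u"
  using support_minus[of "u - v"] by (simp add: polar_form_def add.commute)

lemma polar_form_self: "polar_form u u = (h u)\<^sup>2"
  using support_scaleR[of 2 u] by (simp add: polar_form_def power_mult_distrib scaleR_2)

lemma polar_form_scaleR: "polar_form u (c *\<^sub>R v) = c * polar_form u v"
  using support_expand[of u c v] support_expand[of u "-c" v]
  by (simp add: polar_form_def)

text \<open>The Jordan--von Neumann argument; homogeneity is already known, so no continuity enters.\<close>

lemma polar_form_add: "polar_form (x + y) z = polar_form x z + polar_form y z"
proof -
  have par: "(h (u + v))\<^sup>2 + (h (u - v))\<^sup>2 = 2 * (h u)\<^sup>2 + 2 * (h v)\<^sup>2" for u v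
    using support_expand[of u 1 v] support_expand[of u "-1" v] by simp
  have "x + z + (y + z) = x + y + 2 *\<^sub>R z" "x - z + (y - z) = x + y - 2 *\<^sub>R z"
    "x + z - (y + z) = x - y" "x - z - (y - z) = x - y"
    by (simp_all add: scaleR_2)
  with par[of "x + z" "y + z"] par[of "x - z" "y - z"]
  have "polar_form (x + y) (2 *\<^sub>R z) = 2 * (polar_form x z + polar_form y z)"
    unfolding polar_form_def by (simp add: field_simps)
  then show ?thesis by (simp add: polar_form_scaleR)
qed

lemma linear_polar_form: "linear (\<lambda>u. polar_form u v)"
  by (intro linearI polar_form_add) (metis polar_form_commute polar_form_scaleR real_scaleR_def)

text \<open>The operator that represents \<open>polar_form\<close> in the inner product.\<close>

definition polar_map :: "'a \<Rightarrow> 'a" where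
  "polar_map v = (\<Sum>b\<in>Basis. polar_form b v *\<^sub>R b)"

lemma inner_polar_map: "polar_map v \<bullet> u = polar_form v u"
proof -
  have "polar_map v \<bullet> u = (\<Sum>b\<in>Basis. (u \<bullet> b) * polar_form b v)"
    unfolding polar_map_def inner_sum_left
    by (intro sum.cong) (auto simp: inner_commute)
  also have "\<dots> = polar_form (\<Sum>b\<in>Basis. (u \<bullet> b) *\<^sub>R b) v"
    by (simp add: linear_sum[OF linear_polar_form] linear_scale[OF linear_polar_form])
  finally show ?thesis by (simp add: euclidean_representation polar_form_commute)
qed

lemma linear_polar_map: "linear polar_map"
proof (rule linearI)
  show "polar_map (x + y) = polar_map x + polar_map y" for x y
    by (rule vector_eq_ldot[THEN iffD1]) (metis inner_add_left inner_commute inner_polar_map polar_form_add)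
  show "polar_map (c *\<^sub>R x) = c *\<^sub>R polar_map x" for c x
    by (rule vector_eq_ldot[THEN iffD1])
      (metis inner_commute inner_polar_map inner_scaleR_left polar_form_commute polar_form_scaleR)
qed

lemma bij_polar_map: "bij polar_map"
proof -
  have "v = 0" if "polar_map v = 0" for v
    using inner_polar_map[of v v] support_pos[of v] that by (auto simp: polar_form_self)
  then have "inj polar_map"
    using linear_injective_0[OF linear_polar_map] by blast
  then show ?thesis
    by (simp add: bij_def linear_injective_imp_surjective[OF linear_polar_map])
qed

text \<open>In the coordinates \<open>x = polar_map y\<close> the pairing \<open>x \<bullet> w\<close> is \<open>polar_form y w\<close>, and the supporting
  hyperplane description of the boundary becomes the equality case of the Cauchy--Schwarz
  inequality.\<close>

lemma frontier_polar_map: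
  "polar_map y \<in> frontier D \<longleftrightarrow> polar_form y y = 1"
proof -
  \<comment> \<open>Nonnegativity of \<open>h\<^sup>2\<close> at \<open>w - polar_form y w *\<^sub>R y\<close>.\<close>
  have cauchy: "2 * (polar_form y w)\<^sup>2 \<le> (h w)\<^sup>2 + polar_form y y * (polar_form y w)\<^sup>2" for w
    using zero_le_power2[of "h (w + (- polar_form y w) *\<^sub>R y)"]
    unfolding support_expand by (simp add: polar_form_commute[of w] polar_form_self power2_eq_square algebra_simps)
  show ?thesis
    unfolding frontier_iff_support inner_polar_map
  proof safe
    fix w assume le: "\<forall>w. polar_form y w \<le> h w" and w: "w \<noteq> 0" "polar_form y w = h w"
    have "(h w)\<^sup>2 * 1 \<le> (h w)\<^sup>2 * polar_form y y"
      using cauchy[of w] w by (simp add: mult.commute)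
    then have "1 \<le> polar_form y y"
      using support_pos[OF w(1)] by (subst (asm) mult_le_cancel_left_pos) auto
    moreover have "h y * h y \<le> h y * 1"
      using le[rule_format, of y] by (simp add: polar_form_self power2_eq_square)
    then have "h y \<le> 1"
      using support_nonneg[of y] by (cases "h y = 0") auto
    then have "(h y)\<^sup>2 \<le> 1"
      using support_nonneg[of y] by (simp add: power_le_one)
    ultimately show "polar_form y y = 1" by (simp add: polar_form_self)
  next
    fix w assume one: "polar_form y y = 1"
    have "(polar_form y w)\<^sup>2 \<le> (h w)\<^sup>2" using cauchy[of w] one by simp
    then show "polar_form y w \<le> h w" using support_nonneg[of w] by (rule power2_le_imp_le)
  next
    assume one: "polar_form y y = 1"
    then have "h y = 1" using support_nonneg[of y] by (simp add: polar_form_self power2_eq_1_iff)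
    then show "\<exists>w. w \<noteq> 0 \<and> polar_form y w = h w"
      using one by (intro exI[of _ y]) auto
  qed
qed

end

lemma quadratic_support_ellipsoid:
  fixes D :: "(real ^ 'n) set"
  assumes "quadratic_support D"
  shows "ellipsoid (frontier D)"
proof -
  interpret quadratic_support D by fact
  define T where "T = polar_map"
  define A where "A = matrix (inv T)"
  have T: "linear T" "bij T" "\<And>u v. T u \<bullet> v = polar_form u v"
    unfolding T_def by (rule linear_polar_map bij_polar_map inner_polar_map)+
  have A: "A *v T y = y" for y
  proof -
    have "linear (inv T)" using T by (simp add: inj_linear_imp_inv_linear bij_is_inj)
    then have "A *v T y = inv T (T y)" by (simp add: A_def matrix_works)
    then show ?thesis using T(2) by (simp add: bij_is_inj)
  qed
  have ex: "\<exists>y. x = T y" for x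
    using T(2) by (metis bij_pointE)
  have "transpose A = A"
  proof -
    have "x \<bullet> (A *v z) = (A *v x) \<bullet> z" for x z
    proof -
      obtain y w where "x = T y" "z = T w" using ex by meson
      then show ?thesis using T(3) polar_form_commute by (simp add: A) (metis inner_commute)
    qed
    then have "A $ i $ j = A $ j $ i" for i j
      by (metis cart_eq_inner_axis column_def inner_commute matrix_vector_mul_component matrix_vector_mult_basis vec_lambda_beta)
    then show ?thesis by (simp add: transpose_def vec_eq_iff)
  qed
  moreover have "x \<bullet> (A *v x) > 0" if "x \<noteq> 0" for x
  proof -
    obtain y where y: "x = T y" using ex by blast
    with that have "y \<noteq> 0" using linear_0[OF T(1)] by auto
    with y show ?thesis using support_pos[of y] by (simp add: A T polar_form_self)
  qed
  moreover have "x \<in> frontier D \<longleftrightarrow> x \<bullet> (A *v x) = 1" for x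
  proof -
    obtain y where y: "x = T y" using ex by blast
    then show ?thesis using frontier_polar_map[of y] by (simp add: A T) (simp add: T_def)
  qed
  ultimately show ?thesis
    unfolding ellipsoid_def positive_definite_def
    by (intro exI[of _ A] exI[of _ 0]) auto
qed

section \<open>Measures on an interval with polynomial tails\<close>

text \<open>If the tail function \<open>a \<mapsto> \<mu> {a<..}\<close> of a finite measure carried by \<open>{-r<..<r}\<close> is a polynomial \<open>q\<close>
  on that interval, then \<open>\<mu>\<close> has density \<open>- q'\<close> there.\<close>

lemma power_integral_polynomial_tail:
  fixes \<mu> :: "real measure" and q :: "real poly"
  assumes "finite_measure \<mu>" and sets_\<mu>[measurable_cong]: "sets \<mu> = sets borel"
    and "r > 0"
    and supp: "AE x in \<mu>. - r < x \<and> x < r"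
    and tail: "\<And>a. - r < a \<Longrightarrow> a < r \<Longrightarrow> measure \<mu> {a<..} = poly q a"
  shows "(\<integral>x. x ^ k \<partial>\<mu>) = (\<integral>x. (- poly (pderiv q) x * indicator {-r..r} x) *\<^sub>R x ^ k \<partial>lborel)"
proof -
  interpret finite_measure \<mu> by fact
  \<comment> \<open>\<open>\<mu>\<close> has no atoms at the end points, so the formula for the tails extends to them.\<close>
  have at_r: "poly q r = 0"
  proof (rule LIMSEQ_unique)
    define a where "a = (\<lambda>n. r - r * inverse (real (Suc n)))"
    have "a \<longlonglongrightarrow> r - r * 0"
      unfolding a_def by (intro tendsto_intros LIMSEQ_inverse_real_of_nat)
    then have a: "a \<longlonglongrightarrow> r" by simp
    show "(\<lambda>n. poly q (a n)) \<longlonglongrightarrow> poly q r"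
      by (rule isCont_tendsto_compose[OF poly_isCont a])
    have X: "0 < r * inverse (real (Suc n))" "r * inverse (real (Suc n)) \<le> r * 1" for n
      using \<open>r > 0\<close> by (intro mult_pos_pos mult_left_mono; simp add: field_simps)+
    have anti: "r * inverse (real (Suc n)) \<le> r * inverse (real (Suc m))" if "m \<le> n" for m n
      using \<open>r > 0\<close> that by (intro mult_left_mono le_imp_inverse_le) auto
    have a_less: "- r < a n" "a n < r" for n
      using X[of n] \<open>r > 0\<close> unfolding a_def by linarith+
    have "decseq (\<lambda>n. {a n<..})"
      by (auto simp: decseq_def a_def simp del: of_nat_Suc dest: anti)
    then have "(\<lambda>n. measure \<mu> {a n<..}) \<longlonglongrightarrow> measure \<mu> (\<Inter>n. {a n<..})"
      by (intro finite_Lim_measure_decseq) auto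
    moreover have "measure \<mu> (\<Inter>n. {a n<..}) = 0"
    proof -
      have notin: "x \<notin> (\<Inter>n. {a n<..})" if "x < r" for x
        using eventually_happens[OF order_tendstoD(1)[OF a that]] by (auto dest: less_asym)
      have "AE x in \<mu>. x \<notin> (\<Inter>n. {a n<..})"
        by (rule AE_mp[OF supp], rule AE_I2) (use notin in blast)
      then show ?thesis by (intro measure_eq_0_null_sets) (simp add: AE_iff_null_sets)
    qed
    ultimately show "(\<lambda>n. poly q (a n)) \<longlonglongrightarrow> 0"
      using tail[OF a_less] by simp
  qed
  have at_minus_r: "poly q (- r) = measure \<mu> {- r<..}"
  proof (rule LIMSEQ_unique)
    define a where "a = (\<lambda>n. - r + r * inverse (real (Suc n)))"
    have "a \<longlonglongrightarrow> - r + r * 0"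
      unfolding a_def by (intro tendsto_intros LIMSEQ_inverse_real_of_nat)
    then have a: "a \<longlonglongrightarrow> - r" by simp
    show "(\<lambda>n. poly q (a n)) \<longlonglongrightarrow> poly q (- r)"
      by (rule isCont_tendsto_compose[OF poly_isCont a])
    have X: "0 < r * inverse (real (Suc n))" "r * inverse (real (Suc n)) \<le> r * 1" for n
      using \<open>r > 0\<close> by (intro mult_pos_pos mult_left_mono; simp add: field_simps)+
    have anti: "r * inverse (real (Suc n)) \<le> r * inverse (real (Suc m))" if "m \<le> n" for m n
      using \<open>r > 0\<close> that by (intro mult_left_mono le_imp_inverse_le) auto
    have a_less: "- r < a n" "a n < r" for n
      using X[of n] \<open>r > 0\<close> unfolding a_def by linarith+
    have "incseq (\<lambda>n. {a n<..})"
      by (auto simp: incseq_def a_def simp del: of_nat_Suc dest: anti)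
    then have "(\<lambda>n. measure \<mu> {a n<..}) \<longlonglongrightarrow> measure \<mu> (\<Union>n. {a n<..})"
      by (intro finite_Lim_measure_incseq) auto
    moreover have "(\<Union>n. {a n<..}) = {- r<..}"
    proof safe
      fix x n assume "a n < x" then show "- r < x" using a_less(1)[of n] by simp
    next
      fix x assume "- r < x"
      from order_tendstoD(2)[OF a this] show "x \<in> (\<Union>n. {a n<..})"
        by (auto simp: eventually_sequentially)
    qed
    ultimately show "(\<lambda>n. poly q (a n)) \<longlonglongrightarrow> measure \<mu> {- r<..}"
      using tail[OF a_less] by simp
  qed
  have deriv_nonpos: "poly (pderiv q) x \<le> 0" if "x \<in> {-r..r}" for x
  proof (rule continuous_le_on_closure[where S = "{-r<..<r}" and f = "poly (pderiv q)"])
    show "x \<in> closure {-r<..<r}" using that \<open>r > 0\<close> by simp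
    fix y assume y: "y \<in> {-r<..<r}"
    have "mono_on {-r<..<r} (\<lambda>y. - poly q y)"
    proof (rule mono_onI)
      fix y z assume yz: "y \<in> {-r<..<r}" "z \<in> {-r<..<r}" "y \<le> z"
      have "measure \<mu> {z<..} \<le> measure \<mu> {y<..}"
        using yz by (intro finite_measure_mono) auto
      then show "- poly q y \<le> - poly q z" using yz by (simp add: tail)
    qed
    then have "0 \<le> - poly (pderiv q) y"
      by (rule mono_on_imp_deriv_nonneg)
        (use y in \<open>auto intro!: derivative_eq_intros poly_DERIV simp: interior_open\<close>)
    then show "poly (pderiv q) y \<le> 0" by simp
  qed (auto intro!: continuous_intros)
  define f where "f = (\<lambda>x. - poly (pderiv q) x * indicator {-r..r} x)"
  have f_meas[measurable]: "f \<in> borel_measurable borel"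
    unfolding f_def
    by (intro borel_measurable_times borel_measurable_indicator borel_measurable_continuous_onI
        continuous_intros) simp
  have f_nonneg: "0 \<le> f x" for x
    using deriv_nonpos[of x] by (auto simp: f_def indicator_def)
  have "\<mu> = density lborel (\<lambda>x. ennreal (f x))"
  proof (rule measure_eqI_lessThan)
    show "emeasure \<mu> {a<..} < \<infinity>" for a
      by (simp add: emeasure_eq_measure)
    fix a
    define c where "c = max a (- r)"
    have dens: "emeasure (density lborel (\<lambda>x. ennreal (f x))) {a<..} =
        (\<integral>\<^sup>+ x. ennreal (f x) * indicator {a<..} x \<partial>lborel)"
      by (intro emeasure_density) auto
    have ae: "emeasure \<mu> {a<..} = emeasure \<mu> {c<..}"
    proof (rule emeasure_eq_AE)
      show "AE x in \<mu>. (x \<in> {a<..}) = (x \<in> {c<..})"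
        by (rule AE_mp[OF supp], rule AE_I2) (auto simp: c_def)
    qed simp_all
    show "emeasure \<mu> {a<..} = emeasure (density lborel (\<lambda>x. ennreal (f x))) {a<..}"
    proof (cases "a < r")
      case True
      then have c: "- r \<le> c" "c < r" using \<open>r > 0\<close> by (auto simp: c_def)
      have "measure \<mu> {c<..} = poly q c"
        using c tail[of c] at_minus_r by (cases "c = - r") auto
      then have "emeasure \<mu> {a<..} = ennreal (poly q c)"
        unfolding ae by (simp add: emeasure_eq_measure)
      moreover have "(\<integral>\<^sup>+ x. ennreal (f x) * indicator {a<..} x \<partial>lborel) =
          (\<integral>\<^sup>+ x. ennreal (- poly (pderiv q) x) * indicator {c..r} x \<partial>lborel)"
        by (rule nn_integral_cong_AE, rule AE_mp[OF AE_lborel_singleton[of c]], rule AE_I2)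
          (auto simp: f_def c_def indicator_def)
      moreover have "\<dots> = ennreal (- poly q r - - poly q c)"
      proof (rule nn_integral_FTC_Icc)
        show "(\<lambda>x. - poly (pderiv q) x) \<in> borel_measurable borel"
          by (intro borel_measurable_continuous_onI continuous_intros)
        show "0 \<le> - poly (pderiv q) x" if "x \<in> {c..r}" for x
          using deriv_nonpos[of x] that c by auto
        show "((\<lambda>x. - poly q x) has_real_derivative - poly (pderiv q) x) (at x)" for x
          by (auto intro!: derivative_eq_intros poly_DERIV)
      qed (use c in simp)
      ultimately show ?thesis by (simp add: dens at_r)
    next
      case False
      have "emeasure \<mu> {a<..} = emeasure \<mu> {}"
      proof (rule emeasure_eq_AE)
        show "AE x in \<mu>. (x \<in> {a<..}) = (x \<in> {})"
          by (rule AE_mp[OF supp], rule AE_I2) (use False in auto)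
      qed simp_all
      moreover have "(\<lambda>x. ennreal (f x) * indicator {a<..} x) = (\<lambda>_. 0)"
        using False by (auto simp: f_def indicator_def)
      ultimately show ?thesis by (simp add: dens)
    qed
  qed (simp_all add: sets_\<mu>)
  then have "(\<integral>x. x ^ k \<partial>\<mu>) = (\<integral>x. x ^ k \<partial>density lborel (\<lambda>x. ennreal (f x)))"
    by simp
  also have "\<dots> = (\<integral>x. f x *\<^sub>R x ^ k \<partial>lborel)"
    by (intro integral_density) (auto simp: f_nonneg)
  finally show ?thesis by (simp add: f_def)
qed

lemma integral_poly_times_power:
  fixes p :: "real poly"
  assumes "degree p \<le> N" "r \<ge> 0"
  shows "(\<integral>x. (poly p x * indicator {-r..r} x) *\<^sub>R x ^ k \<partial>lborel) =
    (\<Sum>j\<le>N. coeff p j * (r ^ Suc (k + j) - (- r) ^ Suc (k + j)) / real (Suc (k + j)))"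
proof -
  have "poly p x = (\<Sum>j\<le>N. coeff p j * x ^ j)" for x
    unfolding poly_altdef using assms
    by (intro sum.mono_neutral_left) (auto simp: coeff_eq_0)
  then have "(\<integral>x. (poly p x * indicator {-r..r} x) *\<^sub>R x ^ k \<partial>lborel) =
      (\<integral>x. (\<Sum>j\<le>N. coeff p j * (x ^ (k + j) * indicator {-r..r} x)) \<partial>lborel)"
    by (intro Bochner_Integration.integral_cong) (auto simp: sum_distrib_left sum_distrib_right power_add mult_ac)
  also have "\<dots> = (\<Sum>j\<le>N. (\<integral>x. coeff p j * (x ^ (k + j) * indicator {-r..r} x) \<partial>lborel))"
  proof (intro Bochner_Integration.integral_sum integrable_mult_right)
    show "integrable lborel (\<lambda>x. x ^ (k + j) * indicator {- r..r} x)" for j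
      using borel_integrable_compact[of "{-r..r}" "\<lambda>x. x ^ (k + j)"]
      by (simp add: continuous_intros mult.commute)
  qed
  also have "\<dots> = (\<Sum>j\<le>N. coeff p j * (r ^ Suc (k + j) - (- r) ^ Suc (k + j)) / real (Suc (k + j)))"
    using assms by (intro sum.cong refl) (simp add: integral_power del: power_Suc of_nat_Suc)
  finally show ?thesis .
qed

section \<open>Moments of a convex body\<close>

text \<open>The \<open>k\<close>-th moment of \<open>D\<close> in direction \<open>w\<close>.\<close>

definition moment :: "'a::euclidean_space set \<Rightarrow> nat \<Rightarrow> 'a \<Rightarrow> real" where
  "moment D k w = (\<integral>x. indicator D x *\<^sub>R (x \<bullet> w) ^ k \<partial>lborel)"

text \<open>The common denominator of the sums \<open>\<Sum>j\<le>N. c j / (2 * k + j + 1)\<close>, a polynomial in \<open>k\<close>.\<close>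

definition clearing_factor :: "nat \<Rightarrow> nat \<Rightarrow> real" where
  "clearing_factor N k = (\<Prod>i\<le>N. real (Suc (2 * k + i)))"

lemma clearing_factor_nonzero: "clearing_factor N k \<noteq> 0"
  by (simp add: clearing_factor_def)

lemma moment_scaleR: "moment D k (c *\<^sub>R w) = c ^ k * moment D k w"
proof -
  have "moment D k (c *\<^sub>R w) = (\<integral>x. c ^ k * (indicator D x *\<^sub>R (x \<bullet> w) ^ k) \<partial>lborel)"
    unfolding moment_def by (simp add: power_mult_distrib mult_ac)
  then show ?thesis by (simp add: moment_def)
qed

lemma moment_poly_on_line:
  assumes "bounded D" "open D"
  shows "\<exists>G::real poly. \<forall>t. poly G t = moment D k (u + t *\<^sub>R v)"
proof -
  have int: "integrable lborel (\<lambda>x. indicator D x * ((x \<bullet> u) ^ i * (x \<bullet> v) ^ j))" for i j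
  proof -
    have "set_integrable lborel (closure D) (\<lambda>x. (x \<bullet> u) ^ i * (x \<bullet> v) ^ j)"
      unfolding set_integrable_def using assms
      by (intro borel_integrable_compact) (auto intro!: continuous_intros)
    then have "set_integrable lborel D (\<lambda>x. (x \<bullet> u) ^ i * (x \<bullet> v) ^ j)"
      by (rule set_integrable_subset) (use assms closure_subset in auto)
    then show ?thesis by (simp add: set_integrable_def)
  qed
  define I where "I = (\<lambda>i. \<integral>x. indicator D x * ((x \<bullet> u) ^ i * (x \<bullet> v) ^ (k - i)) \<partial>lborel)"
  define G where "G = (\<Sum>i\<le>k. monom (real (k choose i) * I i) (k - i))"
  have "poly G t = moment D k (u + t *\<^sub>R v)" for t
  proof -
    have "indicator D x *\<^sub>R (x \<bullet> (u + t *\<^sub>R v)) ^ k =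
        (\<Sum>i\<le>k. real (k choose i) * t ^ (k - i) * (indicator D x * ((x \<bullet> u) ^ i * (x \<bullet> v) ^ (k - i))))" for x
      unfolding inner_add_right inner_scaleR_right binomial_ring real_scaleR_def sum_distrib_left
      by (intro sum.cong refl) (simp add: power_mult_distrib mult_ac)
    then have "moment D k (u + t *\<^sub>R v) = (\<Sum>i\<le>k. \<integral>x. real (k choose i) * t ^ (k - i) *
        (indicator D x * ((x \<bullet> u) ^ i * (x \<bullet> v) ^ (k - i))) \<partial>lborel)"
      unfolding moment_def by (simp only:) (intro Bochner_Integration.integral_sum integrable_mult_right int)
    also have "\<dots> = (\<Sum>i\<le>k. real (k choose i) * t ^ (k - i) * I i)"
      unfolding I_def by (intro sum.cong refl integral_mult_right_zero)
    finally show ?thesis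
      by (simp add: G_def poly_sum poly_monom mult_ac)
  qed
  then show ?thesis by blast
qed

text \<open>The hypothesis on volumes is expressed with the caps \<open>{x \<in> D. a < x \<bullet> w}\<close>, which are the
  preimages of the rays \<open>{a<..}\<close>. They are the caps \<open>x \<bullet> (- w) < - a\<close> for the opposite direction.\<close>

locale polynomial_tail_body = symmetric_convex_body D for D :: "'a::euclidean_space set" +
  fixes N :: nat
  assumes polynomial_tail: "norm w = 1 \<Longrightarrow> \<exists>q::real poly. degree q \<le> N \<and>
    (\<forall>a. - h w < a \<longrightarrow> a < h w \<longrightarrow> measure lborel {x \<in> D. a < x \<bullet> w} = poly q a)"
begin

text \<open>Integrating \<open>y ^ (2 * k)\<close> against the polynomial density of the projection of \<open>D\<close> to the line
  spanned by \<open>w\<close>. The coefficients \<open>c\<close> depend on \<open>w\<close> but not on \<open>k\<close>.\<close>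

lemma moment_unit:
  assumes w: "norm w = 1"
  shows "\<exists>c. \<forall>k. moment D (2 * k) w = (h w ^ 2) ^ k * (\<Sum>j\<le>N. c j / real (Suc (2 * k + j)))"
proof -
  have "h w > 0" using w by (intro support_pos) auto
  obtain q :: "real poly" where q: "degree q \<le> N"
    "\<And>a. - h w < a \<Longrightarrow> a < h w \<Longrightarrow> measure lborel {x \<in> D. a < x \<bullet> w} = poly q a"
    using polynomial_tail[OF w] by blast
  have D_meas[measurable]: "D \<in> sets borel" using open_D by simp
  define M where "M = restrict_space lborel D"
  define \<mu> where "\<mu> = distr M borel (\<lambda>x. x \<bullet> w)"
  have meas[measurable]: "(\<lambda>x. x \<bullet> w) \<in> measurable M borel"
    unfolding M_def by (intro measurable_restrict_space1) simp
  have space_M: "space M = D" by (simp add: M_def space_restrict_space)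
  have "finite_measure M"
    by (rule finite_measureI)
      (use emeasure_bounded_finite[OF bounded_D] in \<open>simp add: space_M M_def emeasure_restrict_space\<close>)
  then have fin: "finite_measure \<mu>"
    unfolding \<mu>_def by (rule finite_measure.finite_measure_distr) simp
  have supp: "AE x in \<mu>. - h w < x \<and> x < h w"
  proof -
    have "- h w < x \<bullet> w \<and> x \<bullet> w < h w" if "x \<in> D" for x
      using inner_less_support[OF that, of w] inner_less_support[OF symmetric_D[OF that], of w] w by fastforce
    then show ?thesis unfolding \<mu>_def by (subst AE_distr_iff) (auto simp: space_M)
  qed
  have tail: "measure \<mu> {a<..} = poly q a" if "- h w < a" "a < h w" for a
  proof -
    have "measure \<mu> {a<..} = measure M ((\<lambda>x. x \<bullet> w) -` {a<..} \<inter> space M)"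
      unfolding \<mu>_def by (intro measure_distr) auto
    also have "(\<lambda>x. x \<bullet> w) -` {a<..} \<inter> space M = {x \<in> D. a < x \<bullet> w}"
      by (auto simp: space_M)
    also have "measure M \<dots> = measure lborel {x \<in> D. a < x \<bullet> w}"
      unfolding M_def by (intro measure_restrict_space) auto
    finally show ?thesis using q that by simp
  qed
  define p where "p = - pderiv q"
  have "degree p \<le> N" using q(1) by (simp add: p_def degree_pderiv)
  define c where "c = (\<lambda>j. coeff p j * (h w ^ Suc j - (- h w) ^ Suc j))"
  have "moment D (2 * k) w = (h w ^ 2) ^ k * (\<Sum>j\<le>N. c j / real (Suc (2 * k + j)))" for k
  proof -
    have "moment D (2 * k) w = (\<integral>x. (x \<bullet> w) ^ (2 * k) \<partial>M)"
      unfolding M_def moment_def by (subst integral_restrict_space) auto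
    also have "\<dots> = (\<integral>y. y ^ (2 * k) \<partial>\<mu>)"
      unfolding \<mu>_def by (subst integral_distr) auto
    also have "\<dots> = (\<integral>x. (poly p x * indicator {-h w..h w} x) *\<^sub>R x ^ (2 * k) \<partial>lborel)"
      using power_integral_polynomial_tail[OF fin _ \<open>h w > 0\<close> supp tail] by (simp add: \<mu>_def p_def)
    also have "\<dots> = (\<Sum>j\<le>N. coeff p j * (h w ^ Suc (2 * k + j) - (- h w) ^ Suc (2 * k + j)) / real (Suc (2 * k + j)))"
      using \<open>h w > 0\<close> by (intro integral_poly_times_power \<open>degree p \<le> N\<close>) simp
    also have "\<dots> = (\<Sum>j\<le>N. (h w ^ 2) ^ k * (c j / real (Suc (2 * k + j))))"
    proof (intro sum.cong refl)
      fix j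
      have "x ^ Suc (2 * k + j) = (x ^ 2) ^ k * x ^ Suc j" for x :: real
        by (simp add: power_add power_mult)
      from this[of "h w"] this[of "- h w"]
      have "h w ^ Suc (2 * k + j) - (- h w) ^ Suc (2 * k + j) =
          (h w ^ 2) ^ k * (h w ^ Suc j - (- h w) ^ Suc j)"
        by (simp only: power2_minus right_diff_distrib)
      then show "coeff p j * (h w ^ Suc (2 * k + j) - (- h w) ^ Suc (2 * k + j)) / real (Suc (2 * k + j)) =
          (h w ^ 2) ^ k * (c j / real (Suc (2 * k + j)))"
        by (simp only: c_def times_divide_eq_right mult.left_commute)
    qed
    finally show ?thesis by (simp add: sum_distrib_left)
  qed
  then show ?thesis by blast
qed

text \<open>Homogeneity extends the moment formula from unit vectors to all nonzero vectors, and clearing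
  denominators turns the rational function of \<open>k\<close> into a polynomial.\<close>

lemma moment_exponential_polynomial:
  assumes "w \<noteq> 0"
  shows "\<exists>P::real poly. degree P \<le> N \<and>
    (\<forall>k. clearing_factor N k * moment D (2 * k) w = poly P (real k) * ((h w)\<^sup>2) ^ k)"
proof -
  define e where "e = w /\<^sub>R norm w"
  have e: "norm e = 1" "w = norm w *\<^sub>R e" using assms by (auto simp: e_def)
  obtain c where c: "\<And>k. moment D (2 * k) e = (h e ^ 2) ^ k * (\<Sum>j\<le>N. c j / real (Suc (2 * k + j)))"
    using moment_unit[OF e(1)] by blast
  define P where "P = (\<Sum>j\<le>N. smult (c j) (\<Prod>i\<in>{..N} - {j}. [:real (Suc i), 2:]))"
  have "degree P \<le> N"
    unfolding P_def
  proof (intro degree_sum_le)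
    fix j assume j: "j \<in> {..N}"
    have "degree (\<Prod>i\<in>{..N} - {j}. [:real (Suc i), 2:]) \<le> (\<Sum>i\<in>{..N} - {j}. 1)"
      by (subst degree_prod_eq_sum_degree) (auto intro!: sum_mono)
    also have "\<dots> = N" using j by simp
    finally show "degree (smult (c j) (\<Prod>i\<in>{..N} - {j}. [:real (Suc i), 2:])) \<le> N"
      by (intro order.trans[OF degree_smult_le])
  qed simp
  moreover have "clearing_factor N k * moment D (2 * k) w = poly P (real k) * ((h w)\<^sup>2) ^ k" for k
  proof -
    have "clearing_factor N k * (\<Sum>j\<le>N. c j / real (Suc (2 * k + j))) = poly P (real k)"
      unfolding P_def poly_sum sum_distrib_left
    proof (intro sum.cong refl)
      fix j assume j: "j \<in> {..N}"
      have "clearing_factor N k = real (Suc (2 * k + j)) * (\<Prod>i\<in>{..N} - {j}. real (Suc (2 * k + i)))"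
        unfolding clearing_factor_def using j by (intro prod.remove) auto
      moreover have "poly (\<Prod>i\<in>{..N} - {j}. [:real (Suc i), 2:]) (real k) =
          (\<Prod>i\<in>{..N} - {j}. real (Suc (2 * k + i)))"
        by (simp add: poly_prod algebra_simps)
      ultimately show "clearing_factor N k * (c j / real (Suc (2 * k + j))) =
          poly (smult (c j) (\<Prod>i\<in>{..N} - {j}. [:real (Suc i), 2:])) (real k)"
        by (simp del: of_nat_Suc)
    qed
    then have "clearing_factor N k * moment D (2 * k) e = poly P (real k) * (h e ^ 2) ^ k"
      unfolding c by (metis mult.assoc mult.commute)
    moreover have "moment D (2 * k) w = (norm w ^ 2) ^ k * moment D (2 * k) e"
      by (subst e(2)) (simp only: moment_scaleR power_mult)
    moreover have "(h w)\<^sup>2 = norm w ^ 2 * h e ^ 2"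
      by (subst e(2)) (simp only: support_scaleR power_mult_distrib abs_norm_cancel)
    ultimately show ?thesis
      by (simp only: power_mult_distrib mult.left_commute[of "clearing_factor N k"]
          mult.left_commute[of "poly P (real k)"])
  qed
  ultimately show ?thesis by blast
qed

text \<open>The even moments, multiplied by the clearing factor, are polynomials along the line and have the
  form required by \<open>exponential_polynomial_base\<close> with base \<open>h\<^sup>2\<close>. The zeroth moment is the volume
  of \<open>D\<close>, a nonzero constant.\<close>

lemma support_square_poly_on_line:
  assumes "\<And>t. u + t *\<^sub>R v \<noteq> 0"
  shows "\<exists>A::real poly. \<forall>t. poly A t = (h (u + t *\<^sub>R v))\<^sup>2"
proof -
  obtain P :: "real \<Rightarrow> real poly" where P: "\<And>t. degree (P t) \<le> N"
    "\<And>t k. clearing_factor N k * moment D (2 * k) (u + t *\<^sub>R v) =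
       poly (P t) (real k) * ((h (u + t *\<^sub>R v))\<^sup>2) ^ k"
    using moment_exponential_polynomial[OF assms] by metis
  have "\<forall>k. \<exists>G::real poly. \<forall>t. poly G t = moment D k (u + t *\<^sub>R v)"
    using moment_poly_on_line[OF bounded_D open_D] by blast
  from choice[OF this] obtain G :: "nat \<Rightarrow> real poly"
    where G: "\<And>k t. poly (G k) t = moment D k (u + t *\<^sub>R v)" by blast
  define F where "F = (\<lambda>k. smult (clearing_factor N k) (G (2 * k)))"
  define c where "c = clearing_factor N 0 * measure lborel D"
  show ?thesis
  proof (rule exponential_polynomial_base)
    show "poly (F k) t = poly (P t) (real k) * ((h (u + t *\<^sub>R v))\<^sup>2) ^ k" for t k
      by (simp add: F_def G P)
    show "degree (P t) \<le> N" for t by (rule P)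
    show "(h (u + t *\<^sub>R v))\<^sup>2 \<noteq> 0" for t
      using support_pos[OF assms[of t]] by simp
    have "poly (F 0) t = poly [:c:] t" for t
      by (simp add: F_def G moment_def c_def)
    then show "F 0 = [:c:]" by (intro poly_eq_if_infinite[of UNIV]) (auto simp: infinite_UNIV_char_0)
    have "measure lebesgue D \<noteq> 0"
      using open_not_negligible[OF open_D nonempty_D] bounded_D open_D
      by (simp add: negligible_iff_measure lmeasurable_open)
    then have "measure lborel D \<noteq> 0" using open_D by simp
    then show "c \<noteq> 0" by (simp add: c_def clearing_factor_nonzero)
  qed
qed

text \<open>On lines through the origin this is homogeneity. On the other lines it follows from polynomiality in
  both \<open>u + t *\<^sub>R v\<close> and \<open>v + t *\<^sub>R u\<close>, which are exchanged by \<open>t \<mapsto> 1 / t\<close> up to scaling.\<close>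

lemma support_square_quadratic_on_line:
  "\<exists>b. \<forall>t. (h (u + t *\<^sub>R v))\<^sup>2 = (h u)\<^sup>2 + b * t + (h v)\<^sup>2 * t\<^sup>2"
proof (cases "v = 0")
  case True
  then show ?thesis by (intro exI[of _ 0]) simp
next
  case v: False
  show ?thesis
  proof (cases "\<exists>s. u + s *\<^sub>R v = 0")
    case True
    then obtain s where s: "u = - s *\<^sub>R v" by (metis add_eq_0_iff2 scaleR_minus_left)
    then have "u + t *\<^sub>R v = (t - s) *\<^sub>R v" for t by (simp add: algebra_simps)
    then have "(h (u + t *\<^sub>R v))\<^sup>2 = (h u)\<^sup>2 + (- 2 * s * (h v)\<^sup>2) * t + (h v)\<^sup>2 * t\<^sup>2" for t
      unfolding s by (simp only: support_scaleR power_mult_distrib power2_abs) (simp add: power2_eq_square algebra_simps)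
    then show ?thesis by blast
  next
    case False
    have "v + t *\<^sub>R u \<noteq> 0" for t
    proof
      assume *: "v + t *\<^sub>R u = 0"
      with v have "t \<noteq> 0" by auto
      then have "u + (1 / t) *\<^sub>R v = (1 / t) *\<^sub>R (v + t *\<^sub>R u)" by (simp add: scaleR_add_right)
      with * False show False by simp
    qed
    from support_square_poly_on_line[OF this] obtain B :: "real poly"
      where B: "\<And>t. poly B t = (h (v + t *\<^sub>R u))\<^sup>2" by blast
    obtain A :: "real poly" where A: "\<And>t. poly A t = (h (u + t *\<^sub>R v))\<^sup>2"
      using support_square_poly_on_line[of u v] False by blast
    have "\<exists>a b. A = [:a, b, poly B 0:]"
    proof (rule quadratic_if_reversible)
      fix t :: real assume "t \<noteq> 0"
      then have "u + t *\<^sub>R v = t *\<^sub>R (v + (1 / t) *\<^sub>R u)" by (simp add: scaleR_add_right add.commute)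
      then show "poly A t = t\<^sup>2 * poly B (1 / t)"
        unfolding A B by (simp only: support_scaleR power_mult_distrib power2_abs)
    next
      show "poly B 0 \<noteq> 0" using support_pos[OF v] by (simp add: B)
    qed
    then obtain a b where ab: "A = [:a, b, poly B 0:]" by blast
    have "a = (h u)\<^sup>2" using A[of 0] ab by simp
    moreover have "poly B 0 = (h v)\<^sup>2" by (simp add: B)
    ultimately have "(h (u + t *\<^sub>R v))\<^sup>2 = (h u)\<^sup>2 + b * t + (h v)\<^sup>2 * t\<^sup>2" for t
      using A[of t] ab by (simp add: power2_eq_square algebra_simps)
    then show ?thesis by blast
  qed
qed

end

section \<open>Symmetric bodies with polynomial cap volumes\<close>

theorem corollary1:
  fixes D :: "(real ^ 'n) set"
  assumes "CARD('n) \<ge> 2"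
    and "open D" and "convex D" and "bounded D" and "D \<noteq> {}"
    and "D = uminus ` D"
    and "\<exists>N::nat. \<forall>\<omega>. norm \<omega> = 1 \<longrightarrow>
      (\<exists>q::real poly. degree q \<le> N \<and> (\<forall>p\<in>cut_interval D \<omega>. cap_volume D \<omega> p = poly q p))"
  shows "ellipsoid (frontier D)"
proof -
  interpret symmetric_convex_body D
  proof
    show "- x \<in> D" if "x \<in> D" for x using assms(6) that by blast
  qed (use assms in auto)
  obtain N where N: "\<And>\<omega>. norm \<omega> = 1 \<Longrightarrow>
      \<exists>q::real poly. degree q \<le> N \<and> (\<forall>p\<in>cut_interval D \<omega>. cap_volume D \<omega> p = poly q p)"
    using assms(7) by blast
  interpret polynomial_tail_body D N
  proof
    fix w :: "real ^ 'n" assume w: "norm w = 1"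
    then obtain q :: "real poly" where q: "degree q \<le> N"
      "\<And>p. p \<in> cut_interval D (- w) \<Longrightarrow> cap_volume D (- w) p = poly q p"
      using N[of "- w"] by auto
    \<comment> \<open>The reflection \<open>p \<mapsto> - p\<close> turns the caps in direction \<open>- w\<close> into the tails in direction \<open>w\<close>.\<close>
    have "measure lborel {x \<in> D. a < x \<bullet> w} = poly (pcompose q [:0, -1:]) a"
      if a: "- h w < a" "a < h w" for a
    proof -
      have "\<not> h w \<le> a" using a by simp
      then obtain x where x: "x \<in> D" "a < x \<bullet> w"
        using support_least[of w a] by force
      have "bdd_below ((\<lambda>x. x \<bullet> - w) ` D)"
        by (intro bounded_imp_bdd_below bounded_linear_image bounded_D bounded_linear_inner_left)
      then have "(INF x\<in>D. x \<bullet> - w) \<le> x \<bullet> - w"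
        using x(1) by (rule cINF_lower)
      then have "- a \<in> cut_interval D (- w)"
        using x a support_minus[of w] by (simp add: cut_interval_def support_function_def)
      then have "cap_volume D (- w) (- a) = poly q (- a)" by (rule q)
      moreover have "{x \<in> D. x \<bullet> - w < - a} = {x \<in> D. a < x \<bullet> w}" by auto
      moreover have "{x \<in> D. a < x \<bullet> w} = D \<inter> {x. a < w \<bullet> x}" by (auto simp: inner_commute)
      then have "open {x \<in> D. a < x \<bullet> w}"
        by (simp add: open_D open_Int open_halfspace_gt)
      ultimately show ?thesis
        by (simp add: cap_volume_def poly_pcompose)
    qed
    moreover have "degree (pcompose q [:0, -1:]) \<le> N" using q by (simp add: degree_pcompose)
    ultimately show "\<exists>q::real poly. degree q \<le> N \<and>
        (\<forall>a. - h w < a \<longrightarrow> a < h w \<longrightarrow> measure lborel {x \<in> D. a < x \<bullet> w} = poly q a)"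
      by blast
  qed
  have "quadratic_support D"
    by unfold_locales (rule support_square_quadratic_on_line)
  then show ?thesis by (rule quadratic_support_ellipsoid)
qed

end
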